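(* Let $\mathcal H$ be a Hilbert space, let $H_0$ be a densely defined skew-symmetric operator in $\mathcal H$, and let $(\Omega,\mathcal G_1,\mathcal G_2,F,\omega)$ be a boundary system for $H_0$, where $\Omega$ is the standard symmetric form (restricted to $G(H_0^* )$) and $\omega$ is the standard unitary form on $\mathcal G_1\oplus\mathcal G_2$. Write $F(x,H_0^*x)=(F_1(x),F_2(x))$ for $x\in D(H_0^* )$, with $F_j\colon D(H_0^* )\to\mathcal G_j$. Then an operator $H\subseteq H_0^*$ is skew-self-adjoint if and only if there exists a unitary operator $L$ from $\mathcal G_1$ to $\mathcal G_2$ such that \[ D(H)=\{x\in D(H_0^* ) : L F_1(x)=F_2(x)\}. \]
   Context: All vector spaces are over $\mathbb K\in\{\mathbb R,\mathbb C\}$; inner products $(\cdot\mid\cdot)$ and sesquilinear forms are linear in the first and conjugate linear in the second argument. Operators are linear; $D(A)$ is the domain and $G(A)=\{(x,Ax): x\in D(A)\}$ the graph of $A$; $A\subseteq B$ means $G(A)\subseteq G(B)$. An operator $A$ is skew-symmetric if $A\subseteq -A^*$ and skew-self-adjoint if $A=-A^*$. The standard symmetric form on $\mathcal H\oplus\mathcal H$ is $((x,y),(u,v))\mapsto (x\mid v)_{\mathcal H}+(y\mid u)_{\mathcal H}$. The standard unitary form on $\mathcal G_1\oplus\mathcal G_2$ is $((x,y),(u,v))\mapsto (x\mid u)_{\mathcal G_1}-(y\mid v)_{\mathcal G_2}$. A boundary system $(\Omega,\mathcal G_1,\mathcal G_2,F,\omega)$ for $H_0$ consists of a sesquilinear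 form $\Omega$ on $G(H_0^* )$, two Hilbert spaces $\mathcal G_1,\mathcal G_2$, a linear and surjective mapping $F\colon G(H_0^* )\to\mathcal G_1\oplus\mathcal G_2$ (no continuity is required) and a sesquilinear form $\omega$ on $\mathcal G_1\oplus\mathcal G_2$ such that \[ \Omega((x,H_0^*x),(y,H_0^*y))=\omega(F(x,H_0^*x),F(y,H_0^*y))\qquad (x,y\in D(H_0^* )). \] *)

theory Defs
  imports "HOL-Analysis.Analysis"
begin

section \<open>Scalars: the real or the complex field\<close>

text \<open>
  A type of this class is, through \<open>to_complex\<close>, a copy of the real or of the complex field (as a
  normed field and as a real algebra).  The class lets one statement cover both choices of scalars.
\<close>

class real_or_complex = real_normed_field +
  fixes to_complex :: "'a \<Rightarrow> complex"
  assumes to_complex_one: "to_complex 1 = 1"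
    and to_complex_add: "to_complex (a + b) = to_complex a + to_complex b"
    and to_complex_mult: "to_complex (a * b) = to_complex a * to_complex b"
    and to_complex_scaleR: "to_complex (r *\<^sub>R a) = r *\<^sub>R to_complex a"
    and norm_to_complex: "norm (to_complex a) = norm a"
    and range_to_complex: "range to_complex = \<real> \<or> range to_complex = UNIV"

instantiation real :: real_or_complex
begin
definition to_complex_real :: "real \<Rightarrow> complex" where "to_complex_real = of_real"
instance by standard (auto simp: to_complex_real_def Reals_def scaleR_conv_of_real)
end

instantiation complex :: real_or_complex
begin
definition to_complex_complex :: "complex \<Rightarrow> complex" where "to_complex_complex = (\<lambda>z. z)"
instance by standard (auto simp: to_complex_complex_def)
end

definition scalar_cnj :: "'k::real_or_complex \<Rightarrow> 'k" where
  "scalar_cnj a = inv to_complex (cnj (to_complex a))"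

lemma inj_to_complex: "inj (to_complex :: 'k::real_or_complex \<Rightarrow> complex)"
proof (rule injI)
  fix a b :: 'k
  assume eq: "to_complex a = to_complex b"
  have "to_complex (a - b) + to_complex b = to_complex a"
    by (simp flip: to_complex_add)
  then have "to_complex (a - b) = 0" using eq by simp
  then have "norm (a - b) = 0" by (metis norm_to_complex norm_zero)
  then show "a = b" by simp
qed

lemma to_complex_scalar_cnj: "to_complex (scalar_cnj a) = cnj (to_complex (a :: 'k::real_or_complex))"
proof -
  have "cnj (to_complex a) \<in> range (to_complex :: 'k \<Rightarrow> complex)"
    using range_to_complex[where 'a = 'k] by (metis Reals_cnj_iff UNIV_I rangeI complex_cnj_cnj)
  then show ?thesis by (simp add: scalar_cnj_def f_inv_into_f)
qed

lemma scalar_cnj_real: "scalar_cnj (a::real) = a"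
  by (rule injD[OF inj_to_complex]) (simp add: to_complex_scalar_cnj, simp add: to_complex_real_def)

lemma scalar_cnj_complex: "scalar_cnj (a::complex) = cnj a"
  by (rule injD[OF inj_to_complex]) (simp add: to_complex_scalar_cnj, simp add: to_complex_complex_def)

section \<open>Sesquilinear forms and Hilbert spaces\<close>

text \<open>\<open>S\<close> is meant to be a subspace; the values of \<open>b\<close> outside \<open>S\<close> are irrelevant.\<close>

definition sesquilinear_on ::
  "('k::real_or_complex \<Rightarrow> 'v \<Rightarrow> 'v::ab_group_add) \<Rightarrow> 'v set \<Rightarrow> ('v \<Rightarrow> 'v \<Rightarrow> 'k) \<Rightarrow> bool" where
  "sesquilinear_on s S b \<longleftrightarrow>
     (\<forall>x\<in>S. \<forall>y\<in>S. \<forall>z\<in>S. b (x + y) z = b x z + b y z \<and> b z (x + y) = b z x + b z y) \<and>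
     (\<forall>c. \<forall>x\<in>S. \<forall>y\<in>S. b (s c x) y = c * b x y \<and> b x (s c y) = scalar_cnj c * b x y)"

text \<open>
  The norm of the type is the one given by the inner product \<open>ip\<close> (so \<open>ip\<close> is positive definite),
  and completeness is the class \<open>banach\<close>.
\<close>

locale hilbert_space = vector_space scale
  for scale :: "'k::real_or_complex \<Rightarrow> 'a \<Rightarrow> 'a::banach" +
  fixes ip :: "'a \<Rightarrow> 'a \<Rightarrow> 'k"
  assumes scale_of_real: "scale (of_real r) x = r *\<^sub>R x"
    and ip_sesquilinear: "sesquilinear_on scale UNIV ip"
    and ip_conj: "ip y x = scalar_cnj (ip x y)"
    and ip_norm: "ip x x = of_real ((norm x)\<^sup>2)"

lemma hilbert_space_real:
  "hilbert_space (scaleR :: real \<Rightarrow> 'a \<Rightarrow> 'a) (inner :: 'a::{real_inner,banach} \<Rightarrow> 'a \<Rightarrow> real)"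
  by unfold_locales
    (auto simp: sesquilinear_on_def scalar_cnj_real inner_commute algebra_simps power2_norm_eq_inner)

lemma hilbert_space_complex:
  "hilbert_space ((*) :: complex \<Rightarrow> complex \<Rightarrow> complex) (\<lambda>x y. x * cnj y)"
  by unfold_locales
    (auto simp: sesquilinear_on_def scalar_cnj_complex algebra_simps scaleR_conv_of_real
      complex_norm_square simp del: of_real_power)

section \<open>Operators\<close>

text \<open>
  An operator \<open>A\<close> is represented by its graph.  Thus \<open>D(A)\<close> is \<open>Domain A\<close>, and \<open>A \<subseteq> B\<close> and
  \<open>A = B\<close> are inclusion and equality of sets.
\<close>

definition operator :: "('k::field \<Rightarrow> 'a \<Rightarrow> 'a::ab_group_add) \<Rightarrow> ('a \<times> 'a) set \<Rightarrow> bool" where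
  "operator s A \<longleftrightarrow> single_valued A \<and> module.subspace (module_prod.scale s s) A"

definition app :: "('a \<times> 'b) set \<Rightarrow> 'a \<Rightarrow> 'b" where
  "app A x = (THE y. (x, y) \<in> A)"

definition densely_defined :: "('a::topological_space \<times> 'b) set \<Rightarrow> bool" where
  "densely_defined A \<longleftrightarrow> closure (Domain A) = UNIV"

text \<open>The graph of the adjoint; it is the graph of an operator if \<open>A\<close> is densely defined.\<close>

definition adjoint_op :: "('a \<Rightarrow> 'a \<Rightarrow> 'k) \<Rightarrow> ('a \<times> 'a) set \<Rightarrow> ('a \<times> 'a) set" where
  "adjoint_op ip A = {(y, z). \<forall>(x, w)\<in>A. ip w y = ip x z}"

definition neg_op :: "('a \<times> 'b::uminus) set \<Rightarrow> ('a \<times> 'b) set" where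
  "neg_op A = {(x, - y) | x y. (x, y) \<in> A}"

definition skew_symmetric :: "('a \<Rightarrow> 'a \<Rightarrow> 'k) \<Rightarrow> ('a \<times> 'a::uminus) set \<Rightarrow> bool" where
  "skew_symmetric ip A \<longleftrightarrow> A \<subseteq> neg_op (adjoint_op ip A)"

definition skew_self_adjoint ::
  "('a \<Rightarrow> 'a \<Rightarrow> 'k) \<Rightarrow> ('a \<times> 'a::{topological_space,uminus}) set \<Rightarrow> bool" where
  "skew_self_adjoint ip A \<longleftrightarrow> densely_defined A \<and> A = neg_op (adjoint_op ip A)"

definition unitary_operator ::
  "('k::field \<Rightarrow> 'a \<Rightarrow> 'a::ab_group_add) \<Rightarrow> ('a \<Rightarrow> 'a \<Rightarrow> 'k) \<Rightarrow>
   ('k \<Rightarrow> 'b \<Rightarrow> 'b::ab_group_add) \<Rightarrow> ('b \<Rightarrow> 'b \<Rightarrow> 'k) \<Rightarrow> ('a \<Rightarrow> 'b) \<Rightarrow> bool" where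
  "unitary_operator s1 ip1 s2 ip2 L \<longleftrightarrow>
     Vector_Spaces.linear s1 s2 L \<and> surj L \<and> (\<forall>x y. ip2 (L x) (L y) = ip1 x y)"

section \<open>Boundary systems\<close>

fun standard_symmetric_form ::
  "('h \<Rightarrow> 'h \<Rightarrow> 'k::plus) \<Rightarrow> 'h \<times> 'h \<Rightarrow> 'h \<times> 'h \<Rightarrow> 'k" where
  "standard_symmetric_form ip (x, y) (u, v) = ip x v + ip y u"

fun standard_unitary_form ::
  "('g1 \<Rightarrow> 'g1 \<Rightarrow> 'k::minus) \<Rightarrow> ('g2 \<Rightarrow> 'g2 \<Rightarrow> 'k) \<Rightarrow> 'g1 \<times> 'g2 \<Rightarrow> 'g1 \<times> 'g2 \<Rightarrow> 'k" where
  "standard_unitary_form ip1 ip2 (x, y) (u, v) = ip1 x u - ip2 y v"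

text \<open>
  \<open>\<Omega>\<close> and \<open>F\<close> are total functions of which only the values on the graph of the adjoint matter.
\<close>

locale boundary_system =
  H: hilbert_space s ip + G1: hilbert_space s1 ip1 + G2: hilbert_space s2 ip2
  for s :: "'k::real_or_complex \<Rightarrow> 'h \<Rightarrow> 'h::banach" and ip :: "'h \<Rightarrow> 'h \<Rightarrow> 'k"
    and H0 :: "('h \<times> 'h) set"
    and \<Omega> :: "'h \<times> 'h \<Rightarrow> 'h \<times> 'h \<Rightarrow> 'k"
    and s1 :: "'k \<Rightarrow> 'g1 \<Rightarrow> 'g1::banach" and ip1 :: "'g1 \<Rightarrow> 'g1 \<Rightarrow> 'k"
    and s2 :: "'k \<Rightarrow> 'g2 \<Rightarrow> 'g2::banach" and ip2 :: "'g2 \<Rightarrow> 'g2 \<Rightarrow> 'k"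
    and F :: "'h \<times> 'h \<Rightarrow> 'g1 \<times> 'g2"
    and \<omega> :: "'g1 \<times> 'g2 \<Rightarrow> 'g1 \<times> 'g2 \<Rightarrow> 'k" +
  assumes \<Omega>_sesquilinear:
      "sesquilinear_on (module_prod.scale s s) (adjoint_op ip H0) \<Omega>"
    and F_add: "\<lbrakk>p \<in> adjoint_op ip H0; q \<in> adjoint_op ip H0\<rbrakk> \<Longrightarrow> F (p + q) = F p + F q"
    and F_scale: "p \<in> adjoint_op ip H0 \<Longrightarrow>
      F (module_prod.scale s s c p) = module_prod.scale s1 s2 c (F p)"
    and F_surj: "F ` adjoint_op ip H0 = UNIV"
    and \<omega>_sesquilinear: "sesquilinear_on (module_prod.scale s1 s2) UNIV \<omega>"
    and \<Omega>_eq_\<omega>: "\<lbrakk>x \<in> Domain (adjoint_op ip H0); y \<in> Domain (adjoint_op ip H0)\<rbrakk> \<Longrightarrow>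
      \<Omega> (x, app (adjoint_op ip H0) x) (y, app (adjoint_op ip H0) y) =
      \<omega> (F (x, app (adjoint_op ip H0) x)) (F (y, app (adjoint_op ip H0) y))"

end

theory Submission
  imports Defs
begin

text \<open>
  Two indefinite forms are at work.  The annihilator of a set of pairs under the standard symmetric
  form is minus the adjoint, so skew-self-adjointness of \<open>H\<close> says, density aside, that the graph
  of \<open>H\<close> is its own annihilator (lemmas \<open>neg_adjoint_eq_annihilator\<close>, \<open>adjoint_eq_annihilator\<close>).
  The boundary map \<open>F\<close> carries this form, on the graph of the adjoint of \<open>H0\<close>, onto the standard
  unitary form of the boundary space.  Surjectivity of \<open>F\<close> makes the boundary values of \<open>- H0\<close>
  vanish, because the unitary form is nondegenerate, and it makes taking preimages under \<open>F\<close>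
  respect annihilators.  Hence the skew-self-adjoint restrictions are exactly the preimages of the
  self-annihilating sets \<open>K\<close> of boundary values (\<open>skew_self_adjoint_iff_boundary_values\<close>).  Density
  of the domain comes for free, as such a preimage contains \<open>- H0\<close>.

  It remains to recognize the self-annihilating \<open>K\<close> as the graphs of unitary operators.  The form
  vanishes on \<open>K\<close>, so \<open>K\<close> is the graph of an isometry.  Since \<open>K\<close> is an annihilator, it is closed,
  and no nonzero vector is orthogonal to its domain or to its range; by the projection theorem both
  are the whole space (\<open>eq_graph_of_unitary\<close>).
\<close>

section \<open>Scalars\<close>

lemma to_complex_of_real: "to_complex (of_real r :: 'k::real_or_complex) = of_real r"
  by (simp add: of_real_def to_complex_scaleR to_complex_one)

lemma scalar_cnj_mult_self: "scalar_cnj a * a = of_real ((norm (a :: 'k::real_or_complex))\<^sup>2)"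
  by (rule injD[OF inj_to_complex])
    (simp add: to_complex_mult to_complex_scalar_cnj to_complex_of_real complex_norm_square
      mult.commute norm_to_complex[of a, symmetric] del: of_real_power)

lemma scalar_cnj_mult: "scalar_cnj (a * b) = scalar_cnj a * scalar_cnj (b :: 'k::real_or_complex)"
  by (rule injD[OF inj_to_complex]) (simp add: to_complex_scalar_cnj to_complex_mult)

lemma scalar_cnj_of_real: "scalar_cnj (of_real r :: 'k::real_or_complex) = of_real r"
  by (rule injD[OF inj_to_complex]) (simp add: to_complex_scalar_cnj to_complex_of_real)

lemma scalar_cnj_0: "scalar_cnj (0 :: 'k::real_or_complex) = 0"
  using scalar_cnj_of_real[of 0] by simp

section \<open>Geometry of Hilbert spaces\<close>

context hilbert_space
begin

lemma ip_add_left: "ip (x + y) z = ip x z + ip y z"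
  and ip_add_right: "ip z (x + y) = ip z x + ip z y"
  and ip_scale_left: "ip (scale c x) y = c * ip x y"
  and ip_scale_right: "ip x (scale c y) = scalar_cnj c * ip x y"
  using ip_sesquilinear by (simp_all add: sesquilinear_on_def)

lemma additive_ip_left: "Modules.additive (\<lambda>x. ip x z)"
  and additive_ip_right: "Modules.additive (ip z)"
  by (unfold_locales; simp add: ip_add_left ip_add_right)+

lemmas ip_zero_left = Modules.additive.zero[OF additive_ip_left]
  and ip_minus_left = Modules.additive.minus[OF additive_ip_left]
  and ip_diff_left = Modules.additive.diff[OF additive_ip_left]
  and ip_zero_right = Modules.additive.zero[OF additive_ip_right]
  and ip_minus_right = Modules.additive.minus[OF additive_ip_right]
  and ip_diff_right = Modules.additive.diff[OF additive_ip_right]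

lemma ip_self_eq_0: "ip x x = 0 \<longleftrightarrow> x = 0"
  by (simp add: ip_norm)

lemma ip_eq_0_commute: "ip x y = 0 \<longleftrightarrow> ip y x = 0"
  by (metis ip_conj scalar_cnj_0)

lemma parallelogram_law:
  fixes x y :: 'a
  shows "(norm (x + y))\<^sup>2 + (norm (x - y))\<^sup>2 = 2 * (norm x)\<^sup>2 + 2 * (norm y)\<^sup>2"
proof -
  have "ip (x + y) (x + y) + ip (x - y) (x - y) = 2 * ip x x + 2 * ip y y"
    by (simp add: ip_add_left ip_add_right ip_diff_left ip_diff_right)
  then have "(of_real ((norm (x + y))\<^sup>2 + (norm (x - y))\<^sup>2) :: 'k)
      = of_real (2 * (norm x)\<^sup>2 + 2 * (norm y)\<^sup>2)"
    by (simp only: ip_norm of_real_add of_real_mult of_real_numeral)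
  then show ?thesis by (simp only: of_real_eq_iff)
qed

text \<open>
  Subtracting from \<open>x\<close> its component along \<open>z\<close> shortens it by a definite amount.  That the
  left-hand side is nonnegative is the Cauchy--Schwarz inequality; that it is smaller than
  \<open>(norm x)\<^sup>2\<close> unless \<open>x\<close> is orthogonal to \<open>z\<close> makes nearest points feet of perpendiculars.
\<close>

lemma norm_diff_component:
  assumes "z \<noteq> 0"
  shows "(norm (x - scale (ip x z / of_real ((norm z)\<^sup>2)) z))\<^sup>2
    = (norm x)\<^sup>2 - (norm (ip x z))\<^sup>2 / (norm z)\<^sup>2"
proof -
  define n :: 'k where "n = of_real ((norm z)\<^sup>2)"
  define c where "c = ip x z / n"
  have n: "n \<noteq> 0" using assms by (simp add: n_def)
  have zz: "ip z z = n" by (simp add: ip_norm n_def)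
  have "ip (x - scale c z) (x - scale c z)
      = ip x x - scalar_cnj c * ip x z - c * (ip z x - scalar_cnj c * n)"
    by (simp add: ip_diff_left ip_diff_right ip_scale_left ip_scale_right zz algebra_simps)
  also have "ip z x - scalar_cnj c * n = 0"
  proof -
    have "scalar_cnj n = n" by (simp add: n_def scalar_cnj_of_real del: of_real_power)
    moreover have "c * n = ip x z" using n by (simp add: c_def)
    ultimately show ?thesis using scalar_cnj_mult[of c n] ip_conj[of z x] by simp
  qed
  also have "scalar_cnj c * ip x z = n * (scalar_cnj c * c)"
    using n by (simp add: c_def)
  also have "\<dots> = of_real ((norm (ip x z))\<^sup>2 / (norm z)\<^sup>2)"
  proof -
    have "norm c = norm (ip x z) / (norm z)\<^sup>2"
      by (simp add: c_def n_def norm_divide del: of_real_power)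
    then have "(norm z)\<^sup>2 * (norm c)\<^sup>2 = (norm (ip x z))\<^sup>2 / (norm z)\<^sup>2"
      using assms by (simp add: power2_eq_square)
    then show ?thesis
      unfolding scalar_cnj_mult_self n_def of_real_mult[symmetric] by (rule arg_cong)
  qed
  finally have "ip (x - scale c z) (x - scale c z)
      = ip x x - of_real ((norm (ip x z))\<^sup>2 / (norm z)\<^sup>2)"
    by (simp only: mult_zero_right diff_zero)
  then show ?thesis
    unfolding ip_norm of_real_diff[symmetric] of_real_eq_iff c_def n_def .
qed

lemma Cauchy_Schwarz: "norm (ip x y) \<le> norm x * norm y"
proof (cases "y = 0")
  case False
  then have "0 \<le> (norm x)\<^sup>2 - (norm (ip x y))\<^sup>2 / (norm y)\<^sup>2"
    using norm_diff_component[of y x] zero_le_power2 by metis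
  then have "(norm (ip x y))\<^sup>2 \<le> (norm x * norm y)\<^sup>2"
    using False by (simp add: pos_divide_le_eq power_mult_distrib)
  then show ?thesis by (rule power2_le_imp_le) simp
qed (simp add: ip_zero_right)

lemma bounded_bilinear_ip: "bounded_bilinear ip"
proof
  show "ip (r *\<^sub>R x) y = r *\<^sub>R ip x y" for r x y
    using ip_scale_left[of "of_real r" x y] by (simp only: scale_of_real scaleR_conv_of_real)
  show "ip x (r *\<^sub>R y) = r *\<^sub>R ip x y" for r x y
    using ip_scale_right[of x "of_real r" y]
    by (simp only: scale_of_real scaleR_conv_of_real scalar_cnj_of_real)
  show "\<exists>K. \<forall>x y. norm (ip x y) \<le> norm x * norm y * K"
    by (rule exI[of _ 1]) (simp add: Cauchy_Schwarz)
qed (simp_all add: ip_add_left ip_add_right)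

lemma eq_0_if_orthogonal_to_dense:
  assumes "closure X = UNIV" and "\<And>x. x \<in> X \<Longrightarrow> ip x v = 0"
  shows "v = 0"
proof -
  have "continuous_on UNIV (\<lambda>x. ip x v)"
    by (intro bounded_bilinear.continuous_on[OF bounded_bilinear_ip] continuous_intros)
  then have "closed {x. ip x v = 0}"
    by (simp add: closed_Collect_eq continuous_on_const)
  then have "closure X \<subseteq> {x. ip x v = 0}"
    by (intro closure_minimal) (use assms in auto)
  then have "ip v v = 0" using assms(1) by blast
  then show ?thesis by (simp add: ip_self_eq_0)
qed

text \<open>
  A minimizing sequence for the distance is Cauchy by the parallelogram law, since the midpoint of
  two almost nearest points is again in the convex set.  Completeness enters in the form of
  Cantor's nested sets, applied to the sets of almost nearest points.
\<close>

lemma nearest_point_exists: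
  fixes x :: 'a
  assumes "closed D" and "convex D" and "D \<noteq> {}"
  obtains p where "p \<in> D" and "\<And>y. y \<in> D \<Longrightarrow> norm (x - p) \<le> norm (x - y)"
proof -
  define d where "d = infdist x D"
  have d0: "0 \<le> d" by (simp add: d_def infdist_nonneg)
  have d_le: "d \<le> norm (x - y)" if "y \<in> D" for y
    unfolding d_def using infdist_le[OF that, of x] by (simp add: dist_norm)
  define C where "C n = {y \<in> D. (norm (x - y))\<^sup>2 \<le> d\<^sup>2 + inverse (Suc n)}" for n :: nat
  obtain p where p: "\<And>n. p \<in> C n"
  proof (rule decreasing_closed_nest[of C])
    show "closed (C n)" for n
    proof -
      have "closed {y. (norm (x - y))\<^sup>2 \<le> d\<^sup>2 + inverse (real (Suc n))}"
        by (intro closed_Collect_le continuous_intros)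
      then have "closed (D \<inter> {y. (norm (x - y))\<^sup>2 \<le> d\<^sup>2 + inverse (real (Suc n))})"
        using assms(1) by (rule closed_Int[rotated])
      then show ?thesis by (simp add: C_def Int_def)
    qed
    show "C n \<noteq> {}" for n
    proof -
      have "d < sqrt (d\<^sup>2 + inverse (Suc n))"
        by (rule real_less_rsqrt) simp
      then obtain y where y: "y \<in> D" "dist x y < sqrt (d\<^sup>2 + inverse (Suc n))"
        using assms(3) unfolding d_def infdist_def
        by (auto simp: cInf_less_iff)
      have "(norm (x - y))\<^sup>2 \<le> (sqrt (d\<^sup>2 + inverse (Suc n)))\<^sup>2"
        by (rule power_mono) (use y in \<open>simp_all add: dist_norm\<close>)
      then have "y \<in> C n"
        using y(1) by (simp add: C_def)
      then show ?thesis by blast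
    qed
    show "C n \<subseteq> C m" if "m \<le> n" for m n
    proof -
      have "inverse (real (Suc n)) \<le> inverse (real (Suc m))"
        using that by (intro le_imp_inverse_le) simp_all
      from add_left_mono[OF this, of "d\<^sup>2"] show ?thesis
        unfolding C_def by (blast intro: order_trans)
    qed
    show "\<exists>n. \<forall>y\<in>C n. \<forall>z\<in>C n. dist y z < e" if "e > 0" for e
    proof -
      obtain n where n: "inverse (Suc n) < e\<^sup>2 / 4"
        using reals_Archimedean[of "e\<^sup>2 / 4"] \<open>e > 0\<close> by (auto simp del: of_nat_Suc)
      have "dist y z < e" if "y \<in> C n" "z \<in> C n" for y z
      proof -
        define m where "m = (1/2) *\<^sub>R y + (1/2) *\<^sub>R z"
        have "m \<in> D"
          unfolding m_def using that assms(2) by (intro convexD) (simp_all add: C_def)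
        then have "d\<^sup>2 \<le> (norm (x - m))\<^sup>2"
          using d0 by (intro power_mono d_le)
        moreover have "(norm ((x - y) + (x - z)))\<^sup>2 = 4 * (norm (x - m))\<^sup>2"
        proof -
          have "(x - y) + (x - z) = 2 *\<^sub>R (x - m)"
            by (simp add: m_def algebra_simps flip: scaleR_2)
          then show ?thesis by (simp add: power_mult_distrib)
        qed
        moreover have "(norm ((x - y) - (x - z)))\<^sup>2 = (dist y z)\<^sup>2"
          by (simp add: dist_norm norm_minus_commute)
        ultimately have "(dist y z)\<^sup>2 \<le> 4 * inverse (Suc n)"
          using parallelogram_law[of "x - y" "x - z"] that by (simp add: C_def)
        also have "\<dots> < e\<^sup>2" using n by simp
        finally show ?thesis using \<open>e > 0\<close> by (simp add: power2_less_imp_less)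
      qed
      then show ?thesis by blast
    qed
  qed (rule that)
  have "(norm (x - p))\<^sup>2 \<le> d\<^sup>2"
  proof (rule LIMSEQ_le_const)
    show "(\<lambda>n. d\<^sup>2 + inverse (real (Suc n))) \<longlonglongrightarrow> d\<^sup>2"
      using tendsto_add[OF tendsto_const LIMSEQ_inverse_real_of_nat] by simp
    show "\<exists>N. \<forall>n\<ge>N. (norm (x - p))\<^sup>2 \<le> d\<^sup>2 + inverse (real (Suc n))"
      using p by (auto simp: C_def)
  qed
  then have "norm (x - p) \<le> d" using d0 by (rule power2_le_imp_le)
  then show thesis
    using that[of p] p[of 0] d_le order_trans by (auto simp: C_def)
qed

lemma subspace_imp_convex: "subspace D \<Longrightarrow> convex D"
  by (auto simp: convex_def subspace_add subspace_scale simp flip: scale_of_real)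

text \<open>
  The difference between a point and its nearest point in \<open>D\<close> is orthogonal to \<open>D\<close>: otherwise
  moving along \<open>D\<close> would come nearer.
\<close>

lemma closed_subspace_eq_UNIV:
  assumes "closed D" and "subspace D"
    and orth: "\<And>x. (\<And>y. y \<in> D \<Longrightarrow> ip y x = 0) \<Longrightarrow> x = 0"
  shows "D = UNIV"
proof -
  have "x \<in> D" for x
  proof -
    obtain p where p: "p \<in> D" and near: "\<And>y. y \<in> D \<Longrightarrow> norm (x - p) \<le> norm (x - y)"
      using nearest_point_exists[of D x] assms(1,2) subspace_imp_convex subspace_0 by blast
    have "ip z (x - p) = 0" if z: "z \<in> D" for z
    proof (cases "z = 0")
      case False
      let ?c = "ip (x - p) z / of_real ((norm z)\<^sup>2)"
      have "p + scale ?c z \<in> D"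
        using assms(2) p z by (intro subspace_add subspace_scale)
      from near[OF this] have "(norm (x - p))\<^sup>2 \<le> (norm (x - p - scale ?c z))\<^sup>2"
        by (intro power_mono) (simp_all add: diff_diff_eq)
      also have "\<dots> = (norm (x - p))\<^sup>2 - (norm (ip (x - p) z))\<^sup>2 / (norm z)\<^sup>2"
        using False by (rule norm_diff_component)
      finally have "(norm (ip (x - p) z))\<^sup>2 / (norm z)\<^sup>2 \<le> 0" by simp
      then have "ip (x - p) z = 0"
        using False by (simp add: divide_le_0_iff)
      then show ?thesis by (simp add: ip_eq_0_commute)
    qed (simp add: ip_zero_left)
    then have "x - p = 0" by (rule orth)
    then show ?thesis using p by simp
  qed
  then show ?thesis by blast
qed

end

section \<open>Self-annihilating sets of the standard unitary form\<close>

definition annihilator :: "('v \<Rightarrow> 'v \<Rightarrow> 'k::zero) \<Rightarrow> 'v set \<Rightarrow> 'v set" where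
  "annihilator b S = {q. \<forall>p\<in>S. b p q = 0}"

lemma annihilator_antimono: "S \<subseteq> T \<Longrightarrow> annihilator b T \<subseteq> annihilator b S"
  by (auto simp: annihilator_def)

definition graph_of :: "('a \<Rightarrow> 'b) \<Rightarrow> ('a \<times> 'b) set" where
  "graph_of L = {p. L (fst p) = snd p}"

locale hilbert_space_pair = G1: hilbert_space s1 ip1 + G2: hilbert_space s2 ip2
  for s1 :: "'k::real_or_complex \<Rightarrow> 'a \<Rightarrow> 'a::banach" and ip1 :: "'a \<Rightarrow> 'a \<Rightarrow> 'k"
    and s2 :: "'k \<Rightarrow> 'b \<Rightarrow> 'b::banach" and ip2 :: "'b \<Rightarrow> 'b \<Rightarrow> 'k"
begin

abbreviation "\<omega> \<equiv> standard_unitary_form ip1 ip2"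

lemma mem_annihilator_iff:
  "(u, v) \<in> annihilator \<omega> K \<longleftrightarrow> (\<forall>(x, y)\<in>K. ip1 x u = ip2 y v)"
  by (auto simp: annihilator_def)

lemma annihilator_converse:
  "annihilator (standard_unitary_form ip2 ip1) (K\<inverse>) = (annihilator \<omega> K)\<inverse>"
proof -
  interpret swap: hilbert_space_pair s2 ip2 s1 ip1 ..
  have "(\<forall>(y, x)\<in>K\<inverse>. ip2 y v = ip1 x u) \<longleftrightarrow> (\<forall>(x, y)\<in>K. ip1 x u = ip2 y v)" for u v
    by (simp add: Ball_def split_paired_All) metis
  then show ?thesis
    by (simp only: set_eq_iff split_paired_All swap.mem_annihilator_iff mem_annihilator_iff
        converse_iff simp_thms)
qed

text \<open>The form is indefinite, but each coordinate can be tested against itself separately.\<close>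

lemma standard_unitary_form_nondegenerate:
  assumes "\<And>q. \<omega> p q = 0"
  shows "p = 0"
proof -
  obtain a b where p: "p = (a, b)" by fastforce
  have "ip1 a a = 0" "ip2 b b = 0"
    using assms[of "(a, 0)"] assms[of "(0, b)"]
    by (simp_all add: p G1.ip_zero_right G2.ip_zero_right)
  then show ?thesis by (simp add: p G1.ip_self_eq_0 G2.ip_self_eq_0 zero_prod_def)
qed

text \<open>
  A unitary \<open>L\<close> satisfies \<open>ip1 x u = ip2 (L x) (L u)\<close>, so a pair \<open>(u, v)\<close> annihilates the graph
  exactly if \<open>L u - v\<close> is orthogonal to the range of \<open>L\<close>, which is everything.
\<close>

lemma annihilator_graph_of_unitary:
  assumes "unitary_operator s1 ip1 s2 ip2 L"
  shows "graph_of L = annihilator \<omega> (graph_of L)"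
proof -
  have iso: "ip2 (L x) (L y) = ip1 x y" and surj: "surj L" for x y
    using assms by (simp_all add: unitary_operator_def)
  have "(u, v) \<in> annihilator \<omega> (graph_of L) \<longleftrightarrow> L u = v" for u v
  proof -
    have "(u, v) \<in> annihilator \<omega> (graph_of L) \<longleftrightarrow> (\<forall>x. ip2 (L x) (L u) = ip2 (L x) v)"
      by (auto simp: mem_annihilator_iff graph_of_def iso)
    also have "\<dots> \<longleftrightarrow> (\<forall>y. ip2 y (L u - v) = 0)"
      using surj by (metis G2.ip_diff_right right_minus_eq surjD)
    also have "\<dots> \<longleftrightarrow> L u = v"
      by (metis G2.ip_self_eq_0 G2.ip_zero_right right_minus_eq)
    finally show ?thesis .
  qed
  then show ?thesis by (auto simp: graph_of_def)
qed

end

locale self_annihilating = hilbert_space_pair s1 ip1 s2 ip2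
  for s1 :: "'k::real_or_complex \<Rightarrow> 'a \<Rightarrow> 'a::banach" and ip1 :: "'a \<Rightarrow> 'a \<Rightarrow> 'k"
    and s2 :: "'k \<Rightarrow> 'b \<Rightarrow> 'b::banach" and ip2 :: "'b \<Rightarrow> 'b \<Rightarrow> 'k"
    and K :: "('a \<times> 'b) set" +
  assumes K_eq: "K = annihilator \<omega> K"
begin

lemma mem_K_iff: "(u, v) \<in> K \<longleftrightarrow> (\<forall>(x, y)\<in>K. ip1 x u = ip2 y v)"
  by (subst K_eq) (rule mem_annihilator_iff)

lemma ip_eq: "(u, v) \<in> K \<Longrightarrow> (x, y) \<in> K \<Longrightarrow> ip1 x u = ip2 y v"
  using mem_K_iff by blast

lemma K_add: "(u, v) \<in> K \<Longrightarrow> (x, y) \<in> K \<Longrightarrow> (u + x, v + y) \<in> K"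
  by (subst mem_K_iff) (auto simp: G1.ip_add_right G2.ip_add_right ip_eq)

lemma K_diff: "(u, v) \<in> K \<Longrightarrow> (x, y) \<in> K \<Longrightarrow> (u - x, v - y) \<in> K"
  by (subst mem_K_iff) (auto simp: G1.ip_diff_right G2.ip_diff_right ip_eq)

lemma K_scale: "(u, v) \<in> K \<Longrightarrow> (s1 c u, s2 c v) \<in> K"
  by (subst mem_K_iff) (auto simp: G1.ip_scale_right G2.ip_scale_right ip_eq)

lemma K_zero: "(0, 0) \<in> K"
  by (subst mem_K_iff) (auto simp: G1.ip_zero_right G2.ip_zero_right)

lemma norm_eq:
  assumes "(x, y) \<in> K"
  shows "norm x = norm y"
proof -
  have "(of_real ((norm x)\<^sup>2) :: 'k) = of_real ((norm y)\<^sup>2)"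
    using ip_eq[OF assms assms] by (simp only: G1.ip_norm G2.ip_norm)
  then have "(norm x)\<^sup>2 = (norm y)\<^sup>2" by (simp only: of_real_eq_iff)
  then show ?thesis by simp
qed

text \<open>
  \<open>K\<close> is closed because annihilators are, and its two coordinates have equal norms.  So if first
  coordinates converge, then the second ones form a Cauchy sequence and converge as well.
\<close>

lemma closed_Domain: "closed (Domain K)"
  unfolding closed_sequential_limits
proof (intro allI impI, elim conjE)
  fix X u
  assume "\<forall>n::nat. X n \<in> Domain K" and X: "X \<longlonglongrightarrow> u"
  then have "\<forall>n. \<exists>y. (X n, y) \<in> K" by blast
  then obtain Y where XY: "(X n, Y n) \<in> K" for n by metis
  have "Cauchy Y"
  proof -
    have "dist (X m) (X n) = dist (Y m) (Y n)" for m n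
      using norm_eq[OF K_diff[OF XY XY]] by (simp add: dist_norm)
    then show ?thesis
      using LIMSEQ_imp_Cauchy[OF X] by (simp add: Cauchy_def)
  qed
  then obtain v where Y: "Y \<longlonglongrightarrow> v"
    by (auto simp: Cauchy_convergent_iff convergent_def)
  \<comment> \<open>The equations that define the annihilator pass to the limit.\<close>
  have "ip1 x u = ip2 y v" if "(x, y) \<in> K" for x y
  proof (rule LIMSEQ_unique)
    show "(\<lambda>n. ip1 x (X n)) \<longlonglongrightarrow> ip1 x u"
      by (intro bounded_bilinear.tendsto[OF G1.bounded_bilinear_ip] tendsto_const X)
    have "(\<lambda>n. ip2 y (Y n)) \<longlonglongrightarrow> ip2 y v"
      by (intro bounded_bilinear.tendsto[OF G2.bounded_bilinear_ip] tendsto_const Y)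
    then show "(\<lambda>n. ip1 x (X n)) \<longlonglongrightarrow> ip2 y v"
      by (simp only: ip_eq[OF XY that])
  qed
  then have "(u, v) \<in> K" by (subst mem_K_iff) blast
  then show "u \<in> Domain K" by blast
qed

text \<open>
  \<open>K\<close> leaves no gap in its domain: a vector \<open>u\<close> orthogonal to it gives a pair \<open>(u, 0)\<close>
  annihilating \<open>K\<close>, hence in \<open>K\<close>, hence with coordinates of equal norm.
\<close>

lemma Domain_eq_UNIV: "Domain K = UNIV"
proof (rule G1.closed_subspace_eq_UNIV)
  show "G1.subspace (Domain K)"
    by (rule G1.subspaceI) (blast intro: K_zero K_add K_scale)+
  fix u assume "\<And>x. x \<in> Domain K \<Longrightarrow> ip1 x u = 0"
  then have "(u, 0) \<in> K"
    by (subst mem_K_iff) (auto simp: G2.ip_zero_right Domain_iff)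
  then show "u = 0" using norm_eq by fastforce
qed (rule closed_Domain)

text \<open>
  Exchanging the two spaces turns the domain of \<open>K\<close> into its range, so that the fact about domains
  also gives surjectivity of the operator.
\<close>

lemma self_annihilating_converse: "self_annihilating s2 ip2 s1 ip1 (K\<inverse>)"
proof -
  interpret swap: hilbert_space_pair s2 ip2 s1 ip1 ..
  show ?thesis
    by unfold_locales (simp add: annihilator_converse flip: K_eq)
qed

lemma eq_graph_of_unitary:
  obtains L where "unitary_operator s1 ip1 s2 ip2 L" and "K = graph_of L"
proof -
  interpret swap: self_annihilating s2 ip2 s1 ip1 "K\<inverse>"
    by (rule self_annihilating_converse)
  have "\<forall>x. \<exists>y. (x, y) \<in> K" using Domain_eq_UNIV by blast
  then obtain L where L: "(x, L x) \<in> K" for x by metis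
  \<comment> \<open>Two values at the same \<open>x\<close> differ by the partner of \<open>0\<close>, which has norm \<open>0\<close>.\<close>
  have uniq: "L x = y" if "(x, y) \<in> K" for x y
    using norm_eq[OF K_diff[OF L[of x] that]] by simp
  have "Vector_Spaces.linear s1 s2 L"
    by unfold_locales (intro uniq K_add K_scale L)+
  moreover have "surj L"
    using swap.Domain_eq_UNIV uniq unfolding surj_def by (metis Domain_iff UNIV_I converseD)
  moreover have "ip2 (L x) (L y) = ip1 x y" for x y
    using ip_eq[OF L L] by simp
  ultimately have "unitary_operator s1 ip1 s2 ip2 L"
    by (simp add: unitary_operator_def)
  moreover have "K = graph_of L"
    using L uniq by (force simp: graph_of_def)
  ultimately show thesis by (rule that)
qed

end

section \<open>Adjoints as annihilators\<close>

context hilbert_space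
begin

abbreviation "sym_form \<equiv> standard_symmetric_form ip"

lemma neg_adjoint_eq_annihilator: "neg_op (adjoint_op ip A) = annihilator sym_form A"
proof -
  have "(y, z) \<in> neg_op (adjoint_op ip A) \<longleftrightarrow> (y, - z) \<in> adjoint_op ip A" for y z
    unfolding neg_op_def by force
  also have "(y, - z) \<in> adjoint_op ip A \<longleftrightarrow> (\<forall>(x, w)\<in>A. ip x z + ip w y = 0)" for y z
    by (simp add: adjoint_op_def ip_minus_right eq_neg_iff_add_eq_0 add.commute)
  finally show ?thesis
    by (force simp: annihilator_def)
qed

lemma adjoint_eq_annihilator: "adjoint_op ip A = annihilator sym_form (neg_op A)"
proof -
  have "(y, z) \<in> annihilator sym_form (neg_op A) \<longleftrightarrow> (\<forall>(x, w)\<in>A. ip w y - ip x z = 0)" for y z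
    by (fastforce simp: annihilator_def neg_op_def ip_minus_left)
  then show ?thesis
    by (simp add: set_eq_iff adjoint_op_def)
qed

lemma single_valued_adjoint:
  assumes "densely_defined A"
  shows "single_valued (adjoint_op ip A)"
proof (rule single_valuedI)
  fix y z z' assume *: "(y, z) \<in> adjoint_op ip A" "(y, z') \<in> adjoint_op ip A"
  have "z - z' = 0"
  proof (rule eq_0_if_orthogonal_to_dense)
    show "closure (Domain A) = UNIV" using assms by (simp add: densely_defined_def)
    show "ip x (z - z') = 0" if "x \<in> Domain A" for x
      using that * by (fastforce simp: adjoint_op_def ip_diff_right)
  qed
  then show "z = z'" by simp
qed

end

lemma Domain_neg_op: "Domain (neg_op A) = Domain A"
  by (auto simp: neg_op_def)

section \<open>Skew-self-adjoint restrictions through boundary values\<close>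

text \<open>
  A boundary system with its two forms fixed.  The identity of forms is stated for pairs in the
  graph of the adjoint instead of for elements of its domain, so that annihilators can be compared
  directly.
\<close>

locale boundary_map =
  H: hilbert_space s ip + hilbert_space_pair s1 ip1 s2 ip2
  for s :: "'k::real_or_complex \<Rightarrow> 'h \<Rightarrow> 'h::banach" and ip :: "'h \<Rightarrow> 'h \<Rightarrow> 'k"
    and s1 :: "'k \<Rightarrow> 'g1 \<Rightarrow> 'g1::banach" and ip1 :: "'g1 \<Rightarrow> 'g1 \<Rightarrow> 'k"
    and s2 :: "'k \<Rightarrow> 'g2 \<Rightarrow> 'g2::banach" and ip2 :: "'g2 \<Rightarrow> 'g2 \<Rightarrow> 'k" +
  fixes H0 :: "('h \<times> 'h) set" and F :: "'h \<times> 'h \<Rightarrow> 'g1 \<times> 'g2"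
  assumes dense: "densely_defined H0" and skew: "skew_symmetric ip H0"
    and surj: "F ` adjoint_op ip H0 = UNIV"
    and form_eq: "\<lbrakk>p \<in> adjoint_op ip H0; q \<in> adjoint_op ip H0\<rbrakk> \<Longrightarrow> H.sym_form p q = \<omega> (F p) (F q)"
begin

text \<open>
  Skew-symmetry places \<open>neg_op H0\<close>, with the sign, inside the adjoint: restrictions of the adjoint
  by boundary conditions extend \<open>neg_op H0\<close>, not \<open>H0\<close>.
\<close>

lemma neg_H0_subset: "neg_op H0 \<subseteq> adjoint_op ip H0"
  using skew by (fastforce simp: skew_symmetric_def neg_op_def)

text \<open>
  Elements of \<open>neg_op H0\<close> annihilate the adjoint of \<open>H0\<close>, by definition of the adjoint; so their
  boundary values annihilate everything.
\<close>

lemma boundary_value_neg_H0: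
  assumes "p \<in> neg_op H0"
  shows "F p = 0"
proof (rule standard_unitary_form_nondegenerate)
  fix g
  obtain q where q: "q \<in> adjoint_op ip H0" "g = F q" using surj by blast
  have "H.sym_form p q = 0"
    using q(1) assms by (auto simp: H.adjoint_eq_annihilator annihilator_def)
  then show "\<omega> (F p) g = 0"
    using form_eq[of p q] q neg_H0_subset assms by auto
qed

lemma mem_annihilator_iff_boundary:
  assumes "H \<subseteq> adjoint_op ip H0" and "q \<in> adjoint_op ip H0"
  shows "q \<in> annihilator H.sym_form H \<longleftrightarrow> F q \<in> annihilator \<omega> (F ` H)"
proof -
  have "H.sym_form p q = \<omega> (F p) (F q)" if "p \<in> H" for p
    using that assms by (intro form_eq) auto
  then show ?thesis by (simp add: annihilator_def)
qed

lemma image_boundary_preimage: "F ` {p \<in> adjoint_op ip H0. F p \<in> K} = K"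
proof -
  have "F ` {p \<in> adjoint_op ip H0. F p \<in> K} = F ` adjoint_op ip H0 \<inter> K" by blast
  then show ?thesis by (simp only: surj Int_UNIV_left)
qed

text \<open>
  The surjection \<open>F\<close> carries one form to the other, so it matches the sets that are their own
  annihilators, as long as annihilators are taken inside the adjoint of \<open>H0\<close>.  An \<open>H\<close> that is its
  own annihilator lies there anyway.  For the preimage of a self-annihilating \<open>K\<close> this is no restriction: since \<open>0\<close> is in \<open>K\<close>, the preimage contains
  \<open>neg_op H0\<close>, and the annihilator of \<open>neg_op H0\<close> is that adjoint.
\<close>

lemma skew_self_adjoint_iff_boundary_values:
  assumes H: "H \<subseteq> adjoint_op ip H0"
  shows "skew_self_adjoint ip H \<longleftrightarrow>
    (\<exists>K. K = annihilator \<omega> K \<and> H = {p \<in> adjoint_op ip H0. F p \<in> K})"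
proof
  assume "skew_self_adjoint ip H"
  then have eq: "H = annihilator H.sym_form H"
    by (simp add: skew_self_adjoint_def H.neg_adjoint_eq_annihilator)
  have pre: "p \<in> H \<longleftrightarrow> F p \<in> annihilator \<omega> (F ` H)" if "p \<in> adjoint_op ip H0" for p
    using mem_annihilator_iff_boundary[OF H that] eq by simp
  then have H_eq: "H = {p \<in> adjoint_op ip H0. F p \<in> annihilator \<omega> (F ` H)}"
    using H by blast
  have "F ` H = annihilator \<omega> (F ` H)"
    by (subst (1) H_eq) (rule image_boundary_preimage)
  then show "\<exists>K. K = annihilator \<omega> K \<and> H = {p \<in> adjoint_op ip H0. F p \<in> K}"
    using H_eq by blast
next
  assume "\<exists>K. K = annihilator \<omega> K \<and> H = {p \<in> adjoint_op ip H0. F p \<in> K}"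
  then obtain K where K: "K = annihilator \<omega> K"
    and H_eq: "H = {p \<in> adjoint_op ip H0. F p \<in> K}" by blast
  interpret self_annihilating s1 ip1 s2 ip2 K by unfold_locales (rule K)
  have neg_sub: "neg_op H0 \<subseteq> H"
    using neg_H0_subset boundary_value_neg_H0 K_zero by (auto simp: H_eq zero_prod_def)
  then have "Domain H0 \<subseteq> Domain H"
    using Domain_mono[OF neg_sub] by (simp only: Domain_neg_op)
  then have "densely_defined H"
    using dense closure_mono unfolding densely_defined_def by blast
  moreover have "annihilator H.sym_form H \<subseteq> adjoint_op ip H0"
    unfolding H.adjoint_eq_annihilator using neg_sub by (rule annihilator_antimono)
  then have "annihilator H.sym_form H = {q \<in> adjoint_op ip H0. F q \<in> annihilator \<omega> (F ` H)}"
    using mem_annihilator_iff_boundary[OF H] by blast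
  then have "annihilator H.sym_form H = H"
    by (simp add: H_eq image_boundary_preimage flip: K)
  ultimately show "skew_self_adjoint ip H"
    by (simp add: skew_self_adjoint_def H.neg_adjoint_eq_annihilator)
qed

lemma skew_self_adjoint_iff_unitary:
  assumes H: "H \<subseteq> adjoint_op ip H0"
  shows "skew_self_adjoint ip H \<longleftrightarrow>
    (\<exists>L. unitary_operator s1 ip1 s2 ip2 L \<and> H = {p \<in> adjoint_op ip H0. F p \<in> graph_of L})"
proof -
  have "K = annihilator \<omega> K \<longleftrightarrow> (\<exists>L. unitary_operator s1 ip1 s2 ip2 L \<and> K = graph_of L)" for K
  proof
    assume "K = annihilator \<omega> K"
    then interpret self_annihilating s1 ip1 s2 ip2 K by unfold_locales
    show "\<exists>L. unitary_operator s1 ip1 s2 ip2 L \<and> K = graph_of L"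
      using eq_graph_of_unitary by metis
  qed (auto dest: annihilator_graph_of_unitary)
  then show ?thesis
    by (simp only: skew_self_adjoint_iff_boundary_values[OF H]) blast
qed

end

lemma app_eq: "single_valued A \<Longrightarrow> (x, y) \<in> A \<Longrightarrow> app A x = y"
  unfolding app_def by (blast dest: single_valuedD)

theorem theorem2p5:
  fixes s :: "'k::real_or_complex \<Rightarrow> 'h \<Rightarrow> 'h::banach" and ip :: "'h \<Rightarrow> 'h \<Rightarrow> 'k"
    and s1 :: "'k \<Rightarrow> 'g1 \<Rightarrow> 'g1::banach" and ip1 :: "'g1 \<Rightarrow> 'g1 \<Rightarrow> 'k"
    and s2 :: "'k \<Rightarrow> 'g2 \<Rightarrow> 'g2::banach" and ip2 :: "'g2 \<Rightarrow> 'g2 \<Rightarrow> 'k"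
    and H0 H :: "('h \<times> 'h) set"
    and \<Omega> :: "'h \<times> 'h \<Rightarrow> 'h \<times> 'h \<Rightarrow> 'k"
    and F :: "'h \<times> 'h \<Rightarrow> 'g1 \<times> 'g2"
    and \<omega> :: "'g1 \<times> 'g2 \<Rightarrow> 'g1 \<times> 'g2 \<Rightarrow> 'k"
    and F1 :: "'h \<Rightarrow> 'g1" and F2 :: "'h \<Rightarrow> 'g2"
  assumes "hilbert_space s ip"
    and "operator s H0" and "densely_defined H0" and "skew_symmetric ip H0"
    and "boundary_system s ip H0 \<Omega> s1 ip1 s2 ip2 F \<omega>"
    and "\<And>p q. \<lbrakk>p \<in> adjoint_op ip H0; q \<in> adjoint_op ip H0\<rbrakk> \<Longrightarrow>
           \<Omega> p q = standard_symmetric_form ip p q"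
    and "\<omega> = standard_unitary_form ip1 ip2"
    and "\<And>x. x \<in> Domain (adjoint_op ip H0) \<Longrightarrow>
           F (x, app (adjoint_op ip H0) x) = (F1 x, F2 x)"
    and "operator s H" and "H \<subseteq> adjoint_op ip H0"
  shows "skew_self_adjoint ip H \<longleftrightarrow>
    (\<exists>L. unitary_operator s1 ip1 s2 ip2 L \<and>
         Domain H = {x \<in> Domain (adjoint_op ip H0). L (F1 x) = F2 x})"
proof -
  interpret boundary_system s ip H0 \<Omega> s1 ip1 s2 ip2 F \<omega> by fact
  interpret hilbert_space_pair s1 ip1 s2 ip2 ..
  let ?A = "adjoint_op ip H0"
  have sv: "single_valued ?A" using assms(3) by (rule H.single_valued_adjoint)
  interpret boundary_map s ip s1 ip1 s2 ip2 H0 F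
  proof unfold_locales
    fix p q assume pq: "p \<in> ?A" "q \<in> ?A"
    obtain x y u v where p: "p = (x, y)" and q: "q = (u, v)" by (metis surj_pair)
    have "app ?A x = y" and "app ?A u = v"
      using pq by (simp_all add: p q app_eq[OF sv])
    moreover have "x \<in> Domain ?A" and "u \<in> Domain ?A"
      using pq by (auto simp: p q)
    ultimately have "\<Omega> p q = \<omega> (F p) (F q)"
      using \<Omega>_eq_\<omega>[of x u] by (simp add: p q)
    then show "standard_symmetric_form ip p q = standard_unitary_form ip1 ip2 (F p) (F q)"
      by (simp only: assms(6)[OF pq] assms(7))
  qed (use assms(3,4) F_surj in auto)
  have F_eq: "F (x, y) = (F1 x, F2 x)" if "(x, y) \<in> ?A" for x y
    using assms(8)[of x] that by (auto simp: app_eq[OF sv])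
  \<comment> \<open>As a restriction of the single-valued adjoint, \<open>H\<close> is determined by its domain.\<close>
  have "H = {p \<in> ?A. F p \<in> graph_of L} \<longleftrightarrow>
      Domain H = {x \<in> Domain ?A. L (F1 x) = F2 x}" for L
  proof -
    have mem: "(x, y) \<in> H \<longleftrightarrow> (x, y) \<in> ?A \<and> x \<in> Domain H" for x y
      using assms(10) sv by (auto dest: single_valuedD)
    have "(x, y) \<in> {p \<in> ?A. F p \<in> graph_of L} \<longleftrightarrow> (x, y) \<in> ?A \<and> L (F1 x) = F2 x" for x y
      by (auto simp: graph_of_def F_eq)
    then have "H = {p \<in> ?A. F p \<in> graph_of L} \<longleftrightarrow>
        (\<forall>x y. (x, y) \<in> ?A \<longrightarrow> (x \<in> Domain H \<longleftrightarrow> L (F1 x) = F2 x))"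
      using mem by (auto simp: set_eq_iff)
    also have "\<dots> \<longleftrightarrow> Domain H = {x \<in> Domain ?A. L (F1 x) = F2 x}"
      using assms(10) by blast
    finally show ?thesis .
  qed
  then show ?thesis
    using skew_self_adjoint_iff_unitary[OF assms(10)] by simp
qed

end
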